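(* Let $n\ge 1$ be an integer, let $p\ge 1$ be real, and let $K\subset\mathbb{R}^n$ be the closed unit ball of a norm $\|\cdot\|_K$ on $\mathbb{R}^n$ (equivalently, an origin-symmetric convex body with nonempty interior). If $f\in W^{s,p}(\mathbb{R}^n)$ for all $s\in(0,1)$ and $f$ has compact support, then $$\lim_{s\to 0^+}s\int_{\mathbb{R}^n}\int_{\mathbb{R}^n}\frac{|f(x)-f(y)|^p}{\|x-y\|_K^{n+sp}}\,dx\,dy=\frac{2n}{p}\,|K|\,|f|_p^p.$$
   Context: $|K|$ denotes the $n$-dimensional volume (Lebesgue measure) of $K$, and $|f|_p$ denotes the $L^p$ norm of $f$ on $\mathbb{R}^n$. For $0<s<1$, $W^{s,p}(\mathbb{R}^n)$ is the set of functions $f\in L^p(\mathbb{R}^n)$ (real-valued) with $$\int_{\mathbb{R}^n}\int_{\mathbb{R}^n}\frac{|f(x)-f(y)|^p}{|x-y|^{n+ps}}\,dx\,dy<\infty,$$ where $|x-y|$ is the Euclidean norm. *)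

theory Defs
  imports "HOL-Analysis.Analysis"
begin

definition is_norm :: "('a::real_vector \<Rightarrow> real) \<Rightarrow> bool" where
  "is_norm N \<longleftrightarrow>
     (\<forall>x. 0 \<le> N x) \<and>
     (\<forall>x. N x = 0 \<longleftrightarrow> x = 0) \<and>
     (\<forall>c x. N (c *\<^sub>R x) = \<bar>c\<bar> * N x) \<and>
     (\<forall>x y. N (x + y) \<le> N x + N y)"

definition Lp :: "real \<Rightarrow> (real ^ 'n \<Rightarrow> real) set" where
  "Lp p = {f \<in> borel_measurable lebesgue. integrable lebesgue (\<lambda>x. \<bar>f x\<bar> powr p)}"

definition Lp_norm :: "real \<Rightarrow> (real ^ 'n \<Rightarrow> real) \<Rightarrow> real" where
  "Lp_norm p f = (LINT x|lebesgue. \<bar>f x\<bar> powr p) powr (1 / p)"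

(* Valued in the extended nonnegative reals, so that a divergent integral is \<infinity>.
   On the null set x = y the integrand is 0, by division by zero. *)
definition double_integral ::
    "(real ^ 'n \<Rightarrow> real) \<Rightarrow> real \<Rightarrow> real \<Rightarrow> (real ^ 'n \<Rightarrow> real) \<Rightarrow> ennreal" where
  "double_integral N s p f =
     (\<integral>\<^sup>+ y. (\<integral>\<^sup>+ x. ennreal (\<bar>f x - f y\<bar> powr p / N (x - y) powr (real CARD('n) + s * p))
        \<partial>lebesgue) \<partial>lebesgue)"

definition fractional_Sobolev :: "real \<Rightarrow> real \<Rightarrow> (real ^ 'n \<Rightarrow> real) set" where
  "fractional_Sobolev s p = {f \<in> Lp p. double_integral norm s p f < \<infinity>}"

(* The support of a function considered up to null sets; it is contained in the
   closure of {x. f x \<noteq> 0} for every representative f. *)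
definition ess_support :: "(real ^ 'n \<Rightarrow> real) \<Rightarrow> (real ^ 'n) set" where
  "ess_support f = - \<Union>{U. open U \<and> (AE x in lebesgue. x \<in> U \<longrightarrow> f x = 0)}"

end

theory Submission
  imports Defs
begin

text \<open>
  Choose \<open>R\<close> with \<open>f = 0\<close> a.e. outside \<open>{x. N x \<le> R}\<close> and split the double integral at \<open>N (x - y) = 2 R\<close>.
  On the near part the kernel for \<open>s < 1/2\<close> is bounded by a constant multiple of the kernel for
  \<open>s = 1/2\<close>, so after multiplication by \<open>s\<close> it tends to 0.
  On the far part at most one of \<open>f x\<close>, \<open>f y\<close> is nonzero, so by Tonelli and translation it equals
  \<open>2 \<bar>f\<bar>\<^sub>p\<^sup>p\<close> times the integral of \<open>N z powr - (n + s p)\<close> over \<open>N z > 2 R\<close>, which is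
  \<open>n \<bar>K\<bar> (2 R) powr - (s p) / (s p)\<close>.
\<close>

section \<open>Norms on Euclidean space: continuity, comparison with \<open>norm\<close>, volumes of
  balls\<close>

lemma is_normD:
  assumes "is_norm N"
  shows is_norm_nonneg: "0 \<le> N x"
    and is_norm_eq_0: "N x = 0 \<longleftrightarrow> x = 0"
    and is_norm_scaleR: "N (c *\<^sub>R x) = \<bar>c\<bar> * N x"
    and is_norm_triangle: "N (x + y) \<le> N x + N y"
  using assms by (auto simp: is_norm_def)

lemma is_norm_minus_le:
  assumes "is_norm N"
  shows "N (x - y) \<le> N x + N y"
  using is_norm_triangle[OF assms, of x "- y"] is_norm_scaleR[OF assms, of "-1" y] by simp

text \<open>The triangle inequality and homogeneity make a norm convex, and a convex function on a
  whole Euclidean space is continuous.\<close>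

lemma is_norm_continuous:
  fixes N :: "'a::euclidean_space \<Rightarrow> real"
  assumes "is_norm N"
  shows "continuous_on UNIV N"
proof (rule convex_on_continuous)
  show "convex_on UNIV N"
  proof (rule convex_onI)
    fix t :: real and x y :: 'a
    assume "0 < t" "t < 1"
    then show "N ((1 - t) *\<^sub>R x + t *\<^sub>R y) \<le> (1 - t) * N x + t * N y"
      using is_norm_triangle[OF assms, of "(1 - t) *\<^sub>R x" "t *\<^sub>R y"]
      by (simp add: is_norm_scaleR[OF assms])
  qed simp
qed simp

lemma is_norm_measurable:
  fixes N :: "'a::euclidean_space \<Rightarrow> real"
  assumes "is_norm N"
  shows "N \<in> borel_measurable borel"
  by (intro borel_measurable_continuous_onI is_norm_continuous assms)

text \<open>The constant is the minimum of \<open>N\<close> over the compact Euclidean unit sphere,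
  positive by definiteness; homogeneity carries the bound to all vectors. It gives boundedness of
  \<open>N\<close>-balls and the kernel comparison near the diagonal.\<close>

lemma is_norm_lower_bound:
  fixes N :: "'a::euclidean_space \<Rightarrow> real"
  assumes "is_norm N"
  obtains c where "c > 0" "\<And>x. c * norm x \<le> N x"
proof -
  have "continuous_on (sphere 0 1) N"
    using is_norm_continuous[OF assms] continuous_on_subset by blast
  moreover have "sphere (0::'a) 1 \<noteq> {}"
    using vector_choose_size[of 1] by fastforce
  ultimately obtain u where u: "u \<in> sphere 0 1" "\<And>x. x \<in> sphere 0 1 \<Longrightarrow> N u \<le> N x"
    using continuous_attains_inf[of "sphere 0 1" N] by auto
  have "N u > 0"
    using u(1) is_norm_nonneg[OF assms, of u] is_norm_eq_0[OF assms, of u] by fastforce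
  moreover have "N u * norm x \<le> N x" for x
  proof (cases "x = 0")
    case False
    have "N u \<le> N ((1 / norm x) *\<^sub>R x)"
      using False by (intro u(2)) simp
    then show ?thesis
      using False by (simp add: is_norm_scaleR[OF assms] field_simps)
  qed (use is_norm_nonneg[OF assms] in simp)
  ultimately show thesis using that by blast
qed

lemma is_norm_ball_bounded:
  fixes N :: "'a::euclidean_space \<Rightarrow> real"
  assumes "is_norm N"
  shows "bounded {x. N x \<le> t}"
proof -
  obtain c where c: "c > 0" "\<And>x. c * norm x \<le> N x"
    using is_norm_lower_bound[OF assms] by blast
  have "norm x \<le> t / c" if "N x \<le> t" for x
    using c(2)[of x] that c(1) by (simp add: field_simps)
  then show ?thesis unfolding bounded_iff by blast
qed

lemma is_norm_ball_measurable:
  fixes N :: "'a::euclidean_space \<Rightarrow> real"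
  assumes "is_norm N"
  shows "{x. N x \<le> t} \<in> sets borel"
  using is_norm_measurable[OF assms] by measurable

text \<open>The ball of radius \<open>t\<close> is the dilate by \<open>t\<close> of the unit ball,
  and dilation scales volume by the power \<open>DIM('a)\<close>. Boundedness makes the volume
  finite, so the real-valued \<open>measure\<close> loses nothing.\<close>

lemma emeasure_is_norm_ball:
  fixes N :: "'a::euclidean_space \<Rightarrow> real"
  assumes "is_norm N" "t > 0"
  shows "emeasure lborel {x. N x \<le> t} =
           ennreal (t powr DIM('a) * measure lebesgue {x. N x \<le> 1})"
proof -
  have img: "{x. N x \<le> t} = (\<lambda>x. t *\<^sub>R x + 0) ` {x. N x \<le> 1}"
  proof (intro set_eqI iffI)
    fix x assume "x \<in> {x. N x \<le> t}"
    then have "N ((1 / t) *\<^sub>R x) \<le> 1"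
      using assms(2) by (simp add: is_norm_scaleR[OF assms(1)])
    moreover have "x = t *\<^sub>R ((1 / t) *\<^sub>R x) + 0"
      using assms(2) by simp
    ultimately show "x \<in> (\<lambda>x. t *\<^sub>R x + 0) ` {x. N x \<le> 1}" by blast
  next
    fix x assume "x \<in> (\<lambda>x. t *\<^sub>R x + 0) ` {x. N x \<le> 1}"
    then show "x \<in> {x. N x \<le> t}"
      using assms(2) by (auto simp: is_norm_scaleR[OF assms(1)] mult_left_le)
  qed
  have "{x. N x \<le> 1} \<in> lmeasurable"
    using is_norm_ball_measurable[OF assms(1)]
    by (intro bounded_set_imp_lmeasurable is_norm_ball_bounded[OF assms(1)])
      (simp add: sets_completionI_sets)
  then have "emeasure lebesgue {x. N x \<le> 1} = ennreal (measure lebesgue {x. N x \<le> 1})"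
    by (intro emeasure_eq_ennreal_measure) (auto simp: fmeasurable_def)
  moreover have "emeasure lborel {x. N x \<le> t} = emeasure lebesgue {x. N x \<le> t}"
    using is_norm_ball_measurable[OF assms(1)] by simp
  moreover have "emeasure lebesgue {x. N x \<le> t} =
      ennreal (\<bar>t\<bar> ^ DIM('a)) * emeasure lebesgue {x. N x \<le> 1}"
    unfolding img by (rule emeasure_lebesgue_affine)
  ultimately show ?thesis
    using assms(2) by (simp add: powr_realpow flip: ennreal_mult')
qed

lemma emeasure_is_norm_shell:
  fixes N :: "'a::euclidean_space \<Rightarrow> real"
  assumes "is_norm N" "0 < T" "T \<le> t"
  shows "emeasure lborel {x. T < N x \<and> N x \<le> t} =
           ennreal ((t powr DIM('a) - T powr DIM('a)) * measure lebesgue {x. N x \<le> 1})"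
proof -
  have "{x. T < N x \<and> N x \<le> t} = {x. N x \<le> t} - {x. N x \<le> T}" by auto
  then have "emeasure lborel {x. T < N x \<and> N x \<le> t} =
      emeasure lborel {x. N x \<le> t} - emeasure lborel {x. N x \<le> T}"
    using assms is_norm_ball_measurable[OF assms(1)] emeasure_is_norm_ball[OF assms(1,2)]
    by (simp add: emeasure_Diff Collect_mono)
  then show ?thesis
    using assms by (simp add: emeasure_is_norm_ball ennreal_minus left_diff_distrib)
qed

section \<open>The tail integral of the kernel outside an \<open>N\<close>-ball\<close>

lemma tendsto_powr_neg_at_top:
  fixes b :: real
  assumes "b < 0"
  shows "((\<lambda>t::real. t powr b) \<longlongrightarrow> 0) at_top"
  using assms by (intro tendsto_neg_powr filterlim_ident)

text \<open>Supplies the density for the layer-cake argument, applied there with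
  \<open>r = N z\<close>.\<close>

lemma nn_integral_powr_atLeast:
  fixes a r :: real
  assumes "a > 0" "r > 0"
  shows "(\<integral>\<^sup>+t. ennreal (a * t powr (- a - 1)) * indicator {r..} t \<partial>lborel) = ennreal (r powr - a)"
proof -
  have "(\<integral>\<^sup>+t. ennreal (a * t powr (- a - 1)) * indicator {r..} t \<partial>lborel) = 0 - (- (r powr - a))"
  proof (rule nn_integral_FTC_atLeast[where F = "\<lambda>t. - (t powr - a)"])
    show "((\<lambda>t. - (t powr - a)) \<longlongrightarrow> 0) at_top"
      using tendsto_minus[OF tendsto_powr_neg_at_top[of "- a"]] assms by simp
  next
    fix t assume "r \<le> t"
    then show "((\<lambda>t. - (t powr - a)) has_real_derivative a * t powr (- a - 1)) (at t)"
      using assms by (auto intro!: derivative_eq_intros)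
  qed (use assms in auto)
  then show ?thesis by simp
qed

text \<open>Layer-cake: \<open>N z powr - a\<close> is the integral of \<open>a * t powr (- a - 1)\<close> over \<open>t \<ge> N z\<close>,
  which replaces polar coordinates by the volume of the shells \<open>T < N z \<le> t\<close>.\<close>

lemma nn_integral_is_norm_tail:
  fixes N :: "'a::euclidean_space \<Rightarrow> real" and b :: real
  assumes N: "is_norm N" and T: "T > 0" and b: "b > 0"
  shows "(\<integral>\<^sup>+z. ennreal (1 / N z powr (DIM('a) + b)) * indicator {z. T < N z} z \<partial>lborel) =
           ennreal (DIM('a) * measure lebesgue {z. N z \<le> 1} / b * T powr - b)"
proof -
  define n where "n = real DIM('a)"
  define a where "a = n + b"
  define K where "K = measure lebesgue {z. N z \<le> 1}"
  note [measurable] = is_norm_measurable[OF N]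
  have n: "n > 0" and a: "a > 0" and K: "K \<ge> 0" using b by (auto simp: n_def a_def K_def)
  have "(\<integral>\<^sup>+z. ennreal (1 / N z powr a) * indicator {z. T < N z} z \<partial>lborel) =
      (\<integral>\<^sup>+z. (\<integral>\<^sup>+t. ennreal (a * t powr (- a - 1)) * indicator {N z..} t * indicator {z. T < N z} z
         \<partial>lborel) \<partial>lborel)"
  proof (intro nn_integral_cong)
    fix z
    show "ennreal (1 / N z powr a) * indicator {z. T < N z} z =
      (\<integral>\<^sup>+t. ennreal (a * t powr (- a - 1)) * indicator {N z..} t * indicator {z. T < N z} z \<partial>lborel)"
    proof (cases "T < N z")
      case True
      then show ?thesis
        using nn_integral_powr_atLeast[of a "N z"] T a by (simp add: powr_minus_divide)
    qed simp
  qed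
  \<comment> \<open>Since \<open>T < N z\<close> and \<open>N z \<le> t\<close> force
    \<open>T \<le> t\<close>, the indicator of \<open>{T..}\<close> can be inserted; all dependence
    on \<open>z\<close> then sits in the indicator of a shell.\<close>
  also have "\<dots> = (\<integral>\<^sup>+z. (\<integral>\<^sup>+t. ennreal (a * t powr (- a - 1)) * indicator {T..} t *
         indicator {z. T < N z \<and> N z \<le> t} z \<partial>lborel) \<partial>lborel)"
    by (intro nn_integral_cong) (auto simp: indicator_def)
  also have "\<dots> = (\<integral>\<^sup>+t. (\<integral>\<^sup>+z. ennreal (a * t powr (- a - 1)) * indicator {T..} t *
         indicator {z. T < N z \<and> N z \<le> t} z \<partial>lborel) \<partial>lborel)"
    by (intro lborel_pair.Fubini') simp
  also have "\<dots> = (\<integral>\<^sup>+t. ennreal (a * t powr (- a - 1)) * indicator {T..} t *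
         emeasure lborel {z. T < N z \<and> N z \<le> t} \<partial>lborel)"
    by (intro nn_integral_cong nn_integral_cmult_indicator) simp
  also have "\<dots> = (\<integral>\<^sup>+t. ennreal (K * a * (t powr (- b - 1) - T powr n * t powr (- a - 1))) *
         indicator {T..} t \<partial>lborel)"
  proof (intro nn_integral_cong)
    fix t :: real
    show "ennreal (a * t powr (- a - 1)) * indicator {T..} t *
         emeasure lborel {z. T < N z \<and> N z \<le> t} =
       ennreal (K * a * (t powr (- b - 1) - T powr n * t powr (- a - 1))) * indicator {T..} t"
    proof (cases "T \<le> t")
      case True
      have e: "t powr (- b - 1) = t powr (- a - 1) * t powr n"
        by (simp add: a_def flip: powr_add)
      show ?thesis
        using True a emeasure_is_norm_shell[OF N T True] n_def[symmetric] K_def[symmetric]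
        by (simp add: e algebra_simps flip: ennreal_mult')
    qed simp
  qed
  also have "\<dots> = ennreal (0 - K * (T powr n * T powr - a - a / b * T powr - b))"
  \<comment> \<open>\<open>F\<close> is the termwise antiderivative of the two powers of
    \<open>t\<close>. The instantiation \<open>T = 0\<close> concerns the variable of the rule for
    the limit of \<open>F\<close> at infinity, not the radius \<open>T\<close>.\<close>
  proof (rule nn_integral_FTC_atLeast
      [where F = "\<lambda>t. K * (T powr n * t powr - a - a / b * t powr - b)" and T = 0])
    have "((\<lambda>t. K * (T powr n * t powr - a - a / b * t powr - b)) \<longlongrightarrow>
        K * (T powr n * 0 - a / b * 0)) at_top"
      using a b by (intro tendsto_intros tendsto_powr_neg_at_top) auto
    then show "((\<lambda>t. K * (T powr n * t powr - a - a / b * t powr - b)) \<longlongrightarrow> 0) at_top"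
      by simp
  next
    fix t assume t: "T \<le> t"
    then show "((\<lambda>t. K * (T powr n * t powr - a - a / b * t powr - b)) has_real_derivative
        K * a * (t powr (- b - 1) - T powr n * t powr (- a - 1))) (at t)"
      using T b by (auto intro!: derivative_eq_intros simp: algebra_simps)
    have "T powr n * t powr (- a - 1) \<le> t powr n * t powr (- a - 1)"
      using t T n by (intro mult_right_mono powr_mono2) auto
    also have "\<dots> = t powr (- b - 1)"
      by (simp add: a_def flip: powr_add)
    finally show "0 \<le> K * a * (t powr (- b - 1) - T powr n * t powr (- a - 1))"
      using K a by simp
  qed simp
  \<comment> \<open>As \<open>a = n + b\<close>, both terms are multiples of
    \<open>T powr - b\<close>, with total coefficient \<open>a / b - 1 = n / b\<close>.\<close>
  also have "0 - K * (T powr n * T powr - a - a / b * T powr - b) = n * K / b * T powr - b"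
  proof -
    have "T powr n * T powr - a = T powr - b"
      by (simp add: a_def flip: powr_add)
    then show ?thesis using b by (simp add: a_def field_simps)
  qed
  finally show ?thesis by (simp add: a_def n_def K_def)
qed

section \<open>Passage from Lebesgue to Borel measurability\<close>

lemma double_integral_cong_AE:
  assumes "AE x in lebesgue. f x = g x"
  shows "double_integral N s p f = double_integral N s p g"
  unfolding double_integral_def
\<comment> \<open>The null set is discarded first in the outer variable \<open>y\<close>, then for
  each remaining \<open>y\<close> in the inner variable \<open>x\<close>, so no product measure
  enters.\<close>
proof (rule nn_integral_cong_AE)
  show "AE y in lebesgue.
      (\<integral>\<^sup>+ x. ennreal (\<bar>f x - f y\<bar> powr p / N (x - y) powr (real CARD('a) + s * p)) \<partial>lebesgue) =
      (\<integral>\<^sup>+ x. ennreal (\<bar>g x - g y\<bar> powr p / N (x - y) powr (real CARD('a) + s * p)) \<partial>lebesgue)"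
    using assms
  proof eventually_elim
    case (elim y)
    show ?case
      by (rule nn_integral_cong_AE) (use assms in eventually_elim, simp add: elim)
  qed
qed

text \<open>Completing a measure does not change nonnegative integrals, whatever the integrand. This
  opens the way to Tonelli's theorem on \<open>lborel\<close>.\<close>

lemma double_integral_lborel:
  "double_integral N s p f =
     (\<integral>\<^sup>+ y. (\<integral>\<^sup>+ x. ennreal (\<bar>f x - f y\<bar> powr p / N (x - y) powr (real CARD('n) + s * p))
        \<partial>lborel) \<partial>lborel)"
  for f :: "real ^ 'n \<Rightarrow> real"
  by (simp add: double_integral_def nn_integral_completion)

text \<open>The defining family of open sets is uncountable; Lindelof's theorem reduces it to a countable one.\<close>

lemma AE_ess_support: "AE x in lebesgue. x \<notin> ess_support f \<longrightarrow> f x = 0"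
proof -
  let ?\<U> = "{U. open U \<and> (AE x in lebesgue. x \<in> U \<longrightarrow> f x = 0)}"
  obtain \<U> where \<U>: "\<U> \<subseteq> ?\<U>" "countable \<U>" "\<Union>\<U> = \<Union>?\<U>"
    using Lindelof[of ?\<U>] by auto
  have "AE x in lebesgue. \<forall>U\<in>\<U>. x \<in> U \<longrightarrow> f x = 0"
    using \<U> by (subst AE_ball_countable) auto
  then show ?thesis
  proof eventually_elim
    case (elim x)
    then show ?case
      using \<U>(3) unfolding ess_support_def by auto
  qed
qed

text \<open>A Borel representative makes the integrand jointly Borel measurable. Multiplying by the
  indicator of a ball containing the essential support makes it vanish at every point outside that
  ball, as the pointwise splitting of the far part requires.\<close>

lemma borel_representative:
  fixes f :: "real ^ 'n \<Rightarrow> real"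
  assumes "f \<in> borel_measurable lebesgue" "bounded (ess_support f)"
  obtains g r where "g \<in> borel_measurable borel" "AE x in lebesgue. f x = g x"
    "\<And>x. norm x > r \<Longrightarrow> g x = 0"
proof -
  obtain h where h: "h \<in> borel_measurable borel" "AE x in lborel. f x = h x"
    using completion_ex_borel_measurable_real[OF assms(1)] by auto
  obtain r where r: "\<And>x. x \<in> ess_support f \<Longrightarrow> norm x \<le> r"
    using assms(2) by (auto simp: bounded_iff)
  let ?g = "\<lambda>x. h x * indicator (cball 0 r) x"
  have "AE x in lebesgue. f x = ?g x"
    using AE_completion[OF h(2)] AE_ess_support[of f]
  proof eventually_elim
    case (elim x)
    then show ?case using r[of x] by (auto simp: indicator_def)
  qed
  moreover have "?g \<in> borel_measurable borel" using h(1) by (intro borel_measurable_times borel_measurable_indicator) auto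
  ultimately show thesis using that[of ?g r] by auto
qed

section \<open>The far and near parts of the double integral\<close>

lemma nn_integral_lborel_translate:
  fixes h :: "'a::euclidean_space \<Rightarrow> ennreal"
  assumes "h \<in> borel_measurable borel"
  shows "(\<integral>\<^sup>+x. h (x - y) \<partial>lborel) = (\<integral>\<^sup>+x. h x \<partial>lborel)"
proof -
  have "(\<integral>\<^sup>+x. h x \<partial>lborel) = (\<integral>\<^sup>+x. h x \<partial>distr lborel borel ((+) (- y)))"
    by (simp add: lborel_distr_plus)
  also have "\<dots> = (\<integral>\<^sup>+x. h (- y + x) \<partial>lborel)"
    using assms by (intro nn_integral_distr) auto
  finally show ?thesis by simp
qed

text \<open>By translation invariance the inner integral is \<open>u y\<close> times a constant
  independent of \<open>y\<close>.\<close>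

lemma nn_integral_convolution:
  fixes u h :: "'a::euclidean_space \<Rightarrow> ennreal"
  assumes [measurable]: "u \<in> borel_measurable borel" "h \<in> borel_measurable borel"
  shows "(\<integral>\<^sup>+y. (\<integral>\<^sup>+x. u y * h (x - y) \<partial>lborel) \<partial>lborel) =
           (\<integral>\<^sup>+y. u y \<partial>lborel) * (\<integral>\<^sup>+x. h x \<partial>lborel)"
  by (simp add: nn_integral_cmult nn_integral_lborel_translate nn_integral_multc)

lemma nn_integral_far:
  fixes N g :: "'a::euclidean_space \<Rightarrow> real" and b :: real
  assumes N: "is_norm N" and g[measurable]: "g \<in> borel_measurable borel"
    and supp: "\<And>x. N x > R \<Longrightarrow> g x = 0" and R: "R > 0" and b: "b > 0"
  shows "(\<integral>\<^sup>+y. (\<integral>\<^sup>+x. ennreal (\<bar>g x - g y\<bar> powr p / N (x - y) powr (DIM('a) + b)) *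
             indicator {z. 2 * R < N z} (x - y) \<partial>lborel) \<partial>lborel) =
         2 * (\<integral>\<^sup>+x. ennreal (\<bar>g x\<bar> powr p) \<partial>lborel) *
           ennreal (DIM('a) * measure lebesgue {z. N z \<le> 1} / b * (2 * R) powr - b)"
proof -
  note [measurable] = is_norm_measurable[OF N]
  define h where "h z = ennreal (1 / N z powr (DIM('a) + b)) * indicator {z. 2 * R < N z} z" for z
  define u where "u x = ennreal (\<bar>g x\<bar> powr p)" for x
  have [measurable]: "h \<in> borel_measurable borel" unfolding h_def by measurable
  have [measurable]: "u \<in> borel_measurable borel" unfolding u_def by measurable
  have N_sym: "N (x - y) = N (y - x)" for x y
    using is_norm_scaleR[OF N, of "-1" "x - y"] by simp
  \<comment> \<open>When one of \<open>g x\<close>, \<open>g y\<close> is 0, the power of the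
    difference is the sum of the two powers, because \<open>0 powr p = 0\<close>. Outside the far
    region both sides vanish.\<close>
  have "ennreal (\<bar>g x - g y\<bar> powr p / N (x - y) powr (DIM('a) + b)) *
          indicator {z. 2 * R < N z} (x - y) = u y * h (x - y) + u x * h (y - x)" for x y
  proof (cases "2 * R < N (x - y)")
    case True
    then have "N x > R \<or> N y > R"
      using is_norm_minus_le[OF N, of x y] by linarith
    then have "g x = 0 \<or> g y = 0" using supp by blast
    then have "ennreal (\<bar>g x - g y\<bar> powr p / N (x - y) powr (DIM('a) + b)) =
        u y * ennreal (1 / N (x - y) powr (DIM('a) + b)) + u x * ennreal (1 / N (x - y) powr (DIM('a) + b))"
      by (auto simp: u_def simp flip: ennreal_mult')
    then show ?thesis
      using True by (simp add: h_def N_sym[of y x])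
  qed (simp add: h_def N_sym[of y x])
  then have "(\<integral>\<^sup>+y. (\<integral>\<^sup>+x. ennreal (\<bar>g x - g y\<bar> powr p / N (x - y) powr (DIM('a) + b)) *
             indicator {z. 2 * R < N z} (x - y) \<partial>lborel) \<partial>lborel) =
      (\<integral>\<^sup>+y. (\<integral>\<^sup>+x. u y * h (x - y) \<partial>lborel) \<partial>lborel) +
      (\<integral>\<^sup>+y. (\<integral>\<^sup>+x. u x * h (y - x) \<partial>lborel) \<partial>lborel)"
    by (simp add: nn_integral_add)
  \<comment> \<open>Exchanging the order of integration turns the second summand into a renamed copy
    of the first; this is the source of the factor 2.\<close>
  also have "(\<integral>\<^sup>+y. (\<integral>\<^sup>+x. u x * h (y - x) \<partial>lborel) \<partial>lborel) =
      (\<integral>\<^sup>+x. (\<integral>\<^sup>+y. u x * h (y - x) \<partial>lborel) \<partial>lborel)"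
    by (intro lborel_pair.Fubini') simp
  also have "(\<integral>\<^sup>+y. (\<integral>\<^sup>+x. u y * h (x - y) \<partial>lborel) \<partial>lborel) + \<dots> =
      2 * ((\<integral>\<^sup>+y. u y \<partial>lborel) * (\<integral>\<^sup>+x. h x \<partial>lborel))"
    by (simp add: nn_integral_convolution mult_2)
  also have "(\<integral>\<^sup>+x. h x \<partial>lborel) =
      ennreal (DIM('a) * measure lebesgue {z. N z \<le> 1} / b * (2 * R) powr - b)"
    unfolding h_def using R b by (intro nn_integral_is_norm_tail[OF N]) auto
  finally show ?thesis by (simp add: u_def mult.assoc)
qed

text \<open>The kernel with exponent \<open>s\<close> is \<open>N z powr ((t - s) * p)\<close> times
  the kernel with exponent \<open>t\<close>. The first factor is bounded where
  \<open>N z \<le> T\<close>, and the second is compared with the Euclidean kernel through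
  \<open>c\<close>. The resulting constant does not depend on \<open>s\<close>.\<close>

lemma nn_integral_near_le:
  fixes N g :: "real ^ 'n \<Rightarrow> real"
  assumes N: "is_norm N" and c: "c > 0" "\<And>x. c * norm x \<le> N x"
    and g[measurable]: "g \<in> borel_measurable borel"
    and T: "T \<ge> 1" and s: "0 < s" "s \<le> t" and p: "p > 0"
  shows "(\<integral>\<^sup>+y. (\<integral>\<^sup>+x. ennreal (\<bar>g x - g y\<bar> powr p / N (x - y) powr (real CARD('n) + s * p)) *
             indicator {z. N z \<le> T} (x - y) \<partial>lborel) \<partial>lborel)
         \<le> ennreal (T powr (t * p) / c powr (real CARD('n) + t * p)) * double_integral norm t p g"
    (is "?I \<le> ennreal ?C * _")
proof -
  let ?q = "\<lambda>s. real CARD('n) + s * p"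
  have pw: "ennreal (d / N z powr ?q s) * indicator {z. N z \<le> T} z \<le>
      ennreal ?C * ennreal (d / norm z powr ?q t)" if d: "d \<ge> 0" for d z
  proof (cases "z \<noteq> 0 \<and> N z \<le> T")
    case True
    then have z: "norm z > 0" and Nz: "N z > 0" "N z \<le> T"
      using is_norm_nonneg[OF N, of z] is_norm_eq_0[OF N, of z] by auto
    have q: "?q t > 0" using s p by (simp add: add_pos_pos)
    have "N z powr ((t - s) * p) \<le> T powr ((t - s) * p)"
      using Nz s p by (intro powr_mono2) auto
    \<comment> \<open>\<open>T \<ge> 1\<close> allows the exponent to grow, which removes
      \<open>s\<close> from the bound.\<close>
    also have "\<dots> \<le> T powr (t * p)"
      using T s p by (intro powr_mono) auto
    finally have 1: "N z powr ((t - s) * p) \<le> T powr (t * p)" .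
    have "(c * norm z) powr ?q t \<le> N z powr ?q t"
      using q c(1) z by (intro powr_mono2 c(2)) auto
    then have 2: "c powr ?q t * norm z powr ?q t \<le> N z powr ?q t"
      using c z by (simp add: powr_mult)
    have "1 / N z powr ?q s = N z powr ((t - s) * p) / N z powr ?q t"
      using Nz by (simp add: field_simps flip: powr_add)
    also have "\<dots> \<le> T powr (t * p) / (c powr ?q t * norm z powr ?q t)"
      using 1 2 c z by (intro frac_le) auto
    finally have "d * (1 / N z powr ?q s) \<le> d * (T powr (t * p) / (c powr ?q t * norm z powr ?q t))"
      using d by (rule mult_left_mono)
    then have "d / N z powr ?q s \<le> ?C * (d / norm z powr ?q t)"
      by (simp add: ac_simps)
    then have "ennreal (d / N z powr ?q s) \<le> ennreal (?C * (d / norm z powr ?q t))"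
      by (rule ennreal_leI)
    also have "\<dots> = ennreal ?C * ennreal (d / norm z powr ?q t)"
      by (rule ennreal_mult') simp
    finally show ?thesis
      using True by simp
  \<comment> \<open>For \<open>z = 0\<close> the left side is 0, as \<open>0 powr _ = 0\<close> and
    division by zero gives 0; for \<open>N z > T\<close> the indicator vanishes.\<close>
  qed (use is_norm_eq_0[OF N, of 0] in auto)
  have "?I \<le> (\<integral>\<^sup>+y. (\<integral>\<^sup>+x. ennreal ?C *
      ennreal (\<bar>g x - g y\<bar> powr p / norm (x - y) powr ?q t) \<partial>lborel) \<partial>lborel)"
    by (intro nn_integral_mono pw) simp
  also have "\<dots> = ennreal ?C * double_integral norm t p g"
    by (simp add: nn_integral_cmult double_integral_lborel)
  finally show ?thesis .
qed

section \<open>The limit as \<open>s\<close> tends to 0\<close>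

theorem theorem2:
  fixes p :: real and N :: "real ^ 'n \<Rightarrow> real" and K :: "(real ^ 'n) set"
    and f :: "real ^ 'n \<Rightarrow> real"
  assumes "p \<ge> 1"
    and "is_norm N"
    and "K = {x. N x \<le> 1}"
    and "\<forall>s. 0 < s \<and> s < 1 \<longrightarrow> f \<in> fractional_Sobolev s p"
    and "compact (ess_support f)"
  shows "((\<lambda>s. ennreal s * double_integral N s p f) \<longlongrightarrow>
            ennreal (2 * real CARD('n) / p * measure lebesgue K * Lp_norm p f powr p)) (at_right 0)"
proof -
  note p = assms(1) and N = assms(2) and K = assms(3)
  note [measurable] = is_norm_measurable[OF N]
  \<comment> \<open>The exponent 1/2 serves as the fixed reference for the near part: its finite
    double integral controls all \<open>s < 1/2\<close>.\<close>
  have f: "f \<in> fractional_Sobolev (1/2) p" using assms(4) by simp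
  then have f_meas: "f \<in> borel_measurable lebesgue"
    and f_int: "integrable lebesgue (\<lambda>x. \<bar>f x\<bar> powr p)"
    and f_half: "double_integral norm (1/2) p f < \<infinity>"
    by (auto simp: fractional_Sobolev_def Lp_def)
  obtain g r where g[measurable]: "g \<in> borel_measurable borel"
    and fg: "AE x in lebesgue. f x = g x" and g_supp: "\<And>x. norm x > r \<Longrightarrow> g x = 0"
    using borel_representative[OF f_meas compact_imp_bounded[OF assms(5)]] by blast
  have D_eq: "double_integral M s p f = double_integral M s p g" for M s
    by (rule double_integral_cong_AE[OF fg])

  \<comment> \<open>Continuity of \<open>N\<close> converts the Euclidean bound \<open>r\<close> on
    the support into a bound in terms of \<open>N\<close>.\<close>
  have "compact (N ` cball 0 r)"
    by (intro compact_continuous_image continuous_on_subset[OF is_norm_continuous[OF N]]) auto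
  then have "bounded (N ` cball 0 r)" by (rule compact_imp_bounded)
  then obtain R0 where "\<And>y. y \<in> N ` cball 0 r \<Longrightarrow> norm y \<le> R0"
    unfolding bounded_iff by blast
  then have R0: "N x \<le> R0" if "norm x \<le> r" for x
    using that by force
  \<comment> \<open>The maximum with 1 ensures \<open>2 * R \<ge> 1\<close>, as the near estimate
    demands of its radius.\<close>
  define R where "R = max 1 R0"
  have R: "R \<ge> 1" by (simp add: R_def)
  have supp: "g x = 0" if "N x > R" for x
    using that R0[of x] g_supp[of x] by (force simp: R_def)
  obtain c where c: "c > 0" "\<And>x. c * norm x \<le> N x"
    using is_norm_lower_bound[OF N] by blast

  define G where "G = (LINT x|lebesgue. \<bar>f x\<bar> powr p)"
  have "G \<ge> 0" by (simp add: G_def)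
  then have Lp: "Lp_norm p f powr p = G"
    using p by (simp add: Lp_norm_def G_def[symmetric] powr_powr)
  have "(\<integral>\<^sup>+x. ennreal (\<bar>g x\<bar> powr p) \<partial>lborel) = (\<integral>\<^sup>+x. ennreal (\<bar>g x\<bar> powr p) \<partial>lebesgue)"
    by (simp add: nn_integral_completion)
  also have "\<dots> = (\<integral>\<^sup>+x. ennreal (\<bar>f x\<bar> powr p) \<partial>lebesgue)"
    by (rule nn_integral_cong_AE) (use fg in eventually_elim, simp)
  also have "\<dots> = ennreal G"
    unfolding G_def by (rule nn_integral_eq_integral[OF f_int]) simp
  finally have G: "(\<integral>\<^sup>+x. ennreal (\<bar>g x\<bar> powr p) \<partial>lborel) = ennreal G" .

  define I where "I A s = (\<integral>\<^sup>+y. (\<integral>\<^sup>+x.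
      ennreal (\<bar>g x - g y\<bar> powr p / N (x - y) powr (real CARD('n) + s * p)) *
      indicator A (x - y) \<partial>lborel) \<partial>lborel)" for A s
  let ?near = "{z. N z \<le> 2 * R}" and ?far = "{z. 2 * R < N z}"
  have split: "double_integral N s p f = I ?near s + I ?far s" for s
  proof -
    have "double_integral N s p f = (\<integral>\<^sup>+y. (\<integral>\<^sup>+x.
        ennreal (\<bar>g x - g y\<bar> powr p / N (x - y) powr (real CARD('n) + s * p)) * indicator ?near (x - y) +
        ennreal (\<bar>g x - g y\<bar> powr p / N (x - y) powr (real CARD('n) + s * p)) * indicator ?far (x - y)
        \<partial>lborel) \<partial>lborel)"
      unfolding D_eq unfolding double_integral_lborel by (intro nn_integral_cong) (auto simp: indicator_def)
    then show ?thesis by (simp add: I_def nn_integral_add)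
  qed

  define L where "L = 2 * real CARD('n) / p * measure lebesgue K * G"
  have far: "((\<lambda>s. ennreal s * I ?far s) \<longlongrightarrow> ennreal L) (at_right 0)"
  proof (rule Lim_transform_eventually)
    \<comment> \<open>For \<open>s > 0\<close> the factor \<open>s\<close> cancels the
      \<open>1 / (s * p)\<close> of the tail integral up to \<open>1 / p\<close>, so
      \<open>ennreal s * I ?far s\<close> equals this expression exactly and continuity at 0 gives
      the limit.\<close>
    have "((\<lambda>s. L * (2 * R) powr - (s * p)) \<longlongrightarrow> L * (2 * R) powr - (0 * p)) (at_right 0)"
      using R by (intro tendsto_intros) auto
    then show "((\<lambda>s. ennreal (L * (2 * R) powr - (s * p))) \<longlongrightarrow> ennreal L) (at_right 0)"
      using R by (intro tendsto_ennrealI) simp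
    have "ennreal (L * (2 * R) powr - (s * p)) = ennreal s * I ?far s" if s: "s > 0" for s
    proof -
      have "I ?far s = 2 * ennreal G *
          ennreal (real CARD('n) * measure lebesgue K / (s * p) * (2 * R) powr - (s * p))"
        using nn_integral_far[OF N g supp, of R "s * p" p] R s p by (simp add: I_def G K)
      also have "\<dots> = ennreal (2 * G * (real CARD('n) * measure lebesgue K / (s * p) * (2 * R) powr - (s * p)))"
        using \<open>G \<ge> 0\<close> by (simp only: ennreal_mult' ennreal_numeral mult_nonneg_nonneg zero_le_numeral)
      also have "ennreal s * \<dots> = ennreal (s * (2 * G * (real CARD('n) * measure lebesgue K / (s * p) * (2 * R) powr - (s * p))))"
        using s by (intro ennreal_mult'[symmetric]) simp
      also have "s * (2 * G * (real CARD('n) * measure lebesgue K / (s * p) * (2 * R) powr - (s * p))) =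
          L * (2 * R) powr - (s * p)"
        using s by (simp add: L_def)
      finally show ?thesis ..
    qed
    then show "\<forall>\<^sub>F s in at_right 0. ennreal (L * (2 * R) powr - (s * p)) = ennreal s * I ?far s"
      by (auto simp: eventually_at_filter)
  qed

  \<comment> \<open>Finiteness of the reference integral makes the near bound a real number
    \<open>B\<close>, so that \<open>s * B\<close> tends to 0.\<close>
  obtain B where B: "B \<ge> 0"
    "ennreal ((2 * R) powr (1/2 * p) / c powr (real CARD('n) + 1/2 * p)) * double_integral norm (1/2) p g = ennreal B"
    using f_half unfolding D_eq
    by (metis ennreal_cases ennreal_mult_less_top ennreal_less_top infinity_ennreal_def less_irrefl)
  have near: "((\<lambda>s. ennreal s * I ?near s) \<longlongrightarrow> 0) (at_right 0)"
  proof (rule tendsto_sandwich[where f = "\<lambda>_. 0"])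
    have "((\<lambda>s. s * B) \<longlongrightarrow> 0 * B) (at_right 0)" by (intro tendsto_intros)
    then show "((\<lambda>s. ennreal (s * B)) \<longlongrightarrow> 0) (at_right 0)"
      using tendsto_ennrealI by fastforce
    have "ennreal s * I ?near s \<le> ennreal (s * B)" if s: "0 < s" "s < 1/2" for s
    proof -
      have "I ?near s \<le> ennreal B"
        unfolding I_def B(2)[symmetric] using R s p by (intro nn_integral_near_le[OF N c g]) auto
      then have "ennreal s * I ?near s \<le> ennreal s * ennreal B" by (rule mult_left_mono) simp
      then show ?thesis using s by (simp add: ennreal_mult')
    qed
    then show "\<forall>\<^sub>F s in at_right 0. ennreal s * I ?near s \<le> ennreal (s * B)"
      by (auto simp: eventually_at_right_field intro!: exI[of _ "1/2"])
  qed auto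

  have "((\<lambda>s. ennreal s * I ?near s + ennreal s * I ?far s) \<longlongrightarrow> 0 + ennreal L) (at_right 0)"
    by (intro tendsto_add near far)
  then show ?thesis by (simp add: split distrib_left L_def Lp)
qed

end
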